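(* Let $\Phi(\mathbf{x})=\sum_{k=1}^n\phi_k(x_k)$ be a separable Bregman generator, where each $\phi_k:\mathcal{X}\to\mathbb{R}$ is a Bregman generator. Then for any $\epsilon\ge0$ and random vector $\mathbf{X}=(X_1,\dots,X_n)$: (i) $\mathfrak{B}^n_{\Phi,\epsilon}(\mathbf{X})\subseteq\{\mathbf{Z} : \sum_{i=1}^n\mathcal{B}_{\phi_i}(Z_i,X_i)\le\epsilon\}$; (ii) $\mathfrak{B}^n_{\Phi,\epsilon}(\mathbf{X})\cap\aleph=\{\mathbf{Z} : \sum_{i=1}^n\mathcal{B}_{\phi_i}(Z_i,X_i)\le\epsilon\}\cap\aleph$, where $$\aleph=\{\mathbf{Z} : Z_i, X_i \text{ are comonotonic for all } i\in\{1,\dots,n\}\}.$$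
   Context: All random variables/vectors live on a fixed non-atomic probability space $(\Omega,\mathcal{B},\mathbb{P})$ with $\mathcal{B}=\mathcal{B}(\mathbb{R}^n)$. A Bregman generator is a convex (not necessarily strictly) and differentiable function $\Phi:\mathcal{X}^n\to\mathbb{R}$ on a convex domain $\mathcal{X}^n\subseteq\mathbb{R}^n$; its Bregman divergence is $B_\Phi(\mathbf{z}_1,\mathbf{z}_2)=\Phi(\mathbf{z}_1)-\Phi(\mathbf{z}_2)-\nabla\Phi(\mathbf{z}_2)\cdot(\mathbf{z}_1-\mathbf{z}_2)$. Here $\mathcal{X}\subseteq\mathbb{R}$ is convex, and random vectors take values in the domain $\mathcal{X}^n$ of $\Phi$. The Bregman-Wasserstein (BW) divergence from cdf $F$ to cdf $G$ is $\mathcal{B}^n_\Phi[F,G]=\inf\mathbb{E}[B_\Phi(\mathbf{X},\mathbf{Y})]$, the infimum over all couplings $(\mathbf{X},\mathbf{Y})$ with $F_{\mathbf{X}}=F$, $F_{\mathbf{Y}}=G$. For random vectors, $\mathcal{B}^n_\Phi(\mathbf{X},\mathbf{Y})=\mathcal{B}^n_\Phi[F_{\mathbf{X}},F_{\mathbf{Y}}]$; for $n=1$ the superscript is dropped. The BW uncertainty set is $\mathfrak{B}^n_{\Phi,\epsilon}(\mathbf{X})=\{\mathbf{Z}:\mathcal{B}^n_\Phi[F_{\mathbf{Z}},F_{\mathbf{X}}]\le\epsilon\}$; it is tacitly assumed that such sets contain at least two elements. Two random variables $X,Y$ are comonotonic if there is $\Omega_0\subseteq\Omega$ with $\mathbb{P}(\Omega_0)=1$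 such that $(X(\omega)-X(\omega'))(Y(\omega)-Y(\omega'))\ge0$ for all $\omega,\omega'\in\Omega_0$. *)

theory Defs
  imports "HOL-Probability.Probability"
begin

definition nonatomic :: "'a measure \<Rightarrow> bool" where
  "nonatomic M \<longleftrightarrow>
    (\<forall>A\<in>sets M. 0 < emeasure M A \<longrightarrow>
      (\<exists>B\<in>sets M. B \<subseteq> A \<and> 0 < emeasure M B \<and> emeasure M B < emeasure M A))"

text \<open>
  Random variables and random vectors are treated uniformly: \<open>'b\<close> is \<open>real\<close> or
  \<open>real ^ 'n\<close>, and the order on \<open>real ^ 'n\<close> is the componentwise one, so that
  \<open>rv_cdf\<close> is the usual (joint) distribution function.
\<close>

definition random_vectors :: "'a measure \<Rightarrow> 'b::ordered_euclidean_space set \<Rightarrow> ('a \<Rightarrow> 'b) set" where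
  "random_vectors M S = {X \<in> borel_measurable M. \<forall>\<omega>\<in>space M. X \<omega> \<in> S}"

definition rv_cdf :: "'a measure \<Rightarrow> ('a \<Rightarrow> 'b::ordered_euclidean_space) \<Rightarrow> 'b \<Rightarrow> real" where
  "rv_cdf M X = (\<lambda>x. measure (distr M borel X) {..x})"

text \<open>
  Convexity of the domain \<open>S\<close> is part of \<open>convex_on\<close>. Differentiability is relative to \<open>S\<close>,
  that is, one-sided at those boundary points that belong to \<open>S\<close>.
\<close>

definition bregman_generator :: "'b::ordered_euclidean_space set \<Rightarrow> ('b \<Rightarrow> real) \<Rightarrow> bool" where
  "bregman_generator S \<Phi> \<longleftrightarrow> convex_on S \<Phi> \<and> \<Phi> differentiable_on S"

text \<open>
  If \<open>S\<close> is convex with nonempty interior the gradient is unique. If \<open>S\<close> is convex with empty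
  interior, its inner products with the differences \<open>z1 - z2\<close> of points of \<open>S\<close> still do not
  depend on the choice, so \<open>bregman\<close> below is well defined.
\<close>

definition gradient_within :: "'b::ordered_euclidean_space set \<Rightarrow> ('b \<Rightarrow> real) \<Rightarrow> 'b \<Rightarrow> 'b" where
  "gradient_within S \<Phi> z = (SOME g. (\<Phi> has_derivative (\<lambda>h. g \<bullet> h)) (at z within S))"

definition bregman :: "'b::ordered_euclidean_space set \<Rightarrow> ('b \<Rightarrow> real) \<Rightarrow> 'b \<Rightarrow> 'b \<Rightarrow> real" where
  "bregman S \<Phi> z1 z2 = \<Phi> z1 - \<Phi> z2 - gradient_within S \<Phi> z2 \<bullet> (z1 - z2)"

definition couplings ::
  "'a measure \<Rightarrow> 'b::ordered_euclidean_space set \<Rightarrow> ('b \<Rightarrow> real) \<Rightarrow> ('b \<Rightarrow> real)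
    \<Rightarrow> (('a \<Rightarrow> 'b) \<times> ('a \<Rightarrow> 'b)) set" where
  "couplings M S F G =
    {(X, Y). X \<in> random_vectors M S \<and> Y \<in> random_vectors M S \<and> rv_cdf M X = F \<and> rv_cdf M Y = G}"

text \<open>
  The Bregman divergence of a Bregman generator is nonnegative on its domain, so its expectation
  always exists in \<open>[0, \<infinity>]\<close>; \<open>ennreal\<close> truncates nothing.
\<close>

definition BW_div ::
  "'a measure \<Rightarrow> 'b::ordered_euclidean_space set \<Rightarrow> ('b \<Rightarrow> real) \<Rightarrow> ('b \<Rightarrow> real) \<Rightarrow> ('b \<Rightarrow> real)
    \<Rightarrow> ennreal" where
  "BW_div M S \<Phi> F G =
    (INF (X, Y)\<in>couplings M S F G. \<integral>\<^sup>+\<omega>. ennreal (bregman S \<Phi> (X \<omega>) (Y \<omega>)) \<partial>M)"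

definition BW_div_rv ::
  "'a measure \<Rightarrow> 'b::ordered_euclidean_space set \<Rightarrow> ('b \<Rightarrow> real) \<Rightarrow> ('a \<Rightarrow> 'b) \<Rightarrow> ('a \<Rightarrow> 'b)
    \<Rightarrow> ennreal" where
  "BW_div_rv M S \<Phi> X Y = BW_div M S \<Phi> (rv_cdf M X) (rv_cdf M Y)"

definition BW_set ::
  "'a measure \<Rightarrow> 'b::ordered_euclidean_space set \<Rightarrow> ('b \<Rightarrow> real) \<Rightarrow> real \<Rightarrow> ('a \<Rightarrow> 'b)
    \<Rightarrow> ('a \<Rightarrow> 'b) set" where
  "BW_set M S \<Phi> \<epsilon> X =
    {Z \<in> random_vectors M S. BW_div M S \<Phi> (rv_cdf M Z) (rv_cdf M X) \<le> ennreal \<epsilon>}"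

definition comonotonic :: "'a measure \<Rightarrow> ('a \<Rightarrow> real) \<Rightarrow> ('a \<Rightarrow> real) \<Rightarrow> bool" where
  "comonotonic M X Y \<longleftrightarrow>
    (\<exists>\<Omega>0\<in>sets M. measure M \<Omega>0 = 1 \<and>
      (\<forall>\<omega>\<in>\<Omega>0. \<forall>\<omega>'\<in>\<Omega>0. 0 \<le> (X \<omega> - X \<omega>') * (Y \<omega> - Y \<omega>')))"

definition power_domain :: "real set \<Rightarrow> (real ^ 'n) set" where
  "power_domain D = {x. \<forall>i. x $ i \<in> D}"

definition componentwise_BW_set ::
  "'a measure \<Rightarrow> real set \<Rightarrow> ('n::finite \<Rightarrow> real \<Rightarrow> real) \<Rightarrow> real \<Rightarrow> ('a \<Rightarrow> real ^ 'n)
    \<Rightarrow> ('a \<Rightarrow> real ^ 'n) set" where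
  "componentwise_BW_set M D \<phi> \<epsilon> X =
    {Z \<in> random_vectors M (power_domain D).
      (\<Sum>i\<in>UNIV. BW_div_rv M D (\<phi> i) (\<lambda>\<omega>. Z \<omega> $ i) (\<lambda>\<omega>. X \<omega> $ i)) \<le> ennreal \<epsilon>}"

definition componentwise_comonotonic ::
  "'a measure \<Rightarrow> real set \<Rightarrow> ('a \<Rightarrow> real ^ 'n) \<Rightarrow> ('a \<Rightarrow> real ^ 'n) set" where
  "componentwise_comonotonic M D X =
    {Z \<in> random_vectors M (power_domain D).
      \<forall>i. comonotonic M (\<lambda>\<omega>. Z \<omega> $ i) (\<lambda>\<omega>. X \<omega> $ i)}"

end

theory Submission
  imports Defs
begin

text \<open>
  A separable generator has the Bregman divergence
  \<open>B\<^bsub>\<Phi>\<^esub>(x, y) = (\<Sum>k. B\<^bsub>\<phi>\<^sub>k\<^esub>(x\<^sub>k, y\<^sub>k))\<close>, and a coupling of random vectors restricts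
  to couplings of the components, which gives (i). For (ii) it remains to see that a comonotonic
  pair attains the one-dimensional infimum. Integrating \<open>\<phi>'(t) - \<phi>'(y)\<close> over \<open>t\<close> between \<open>y\<close> and
  \<open>x\<close> writes \<open>B\<^bsub>\<phi>\<^esub>(x, y)\<close> as the Lebesgue measure of the set of \<open>(t, s)\<close> with
  \<open>\<phi>'(y) < s \<le> \<phi>'(t)\<close>, \<open>t < x\<close> or \<open>\<phi>'(t) < s \<le> \<phi>'(y)\<close>, \<open>x \<le> t\<close>. By Tonelli it suffices to
  minimise, for each \<open>(t, s)\<close>, the probability of an intersection of an event determined by the
  first variable and an event determined by the second. Under comonotonicity these two events
  are almost surely disjoint or almost surely cover the space, so their intersection is as small as
  the marginals permit. No integrability is required.
\<close>

section \<open>Gradients and Bregman divergences on convex domains\<close>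

text \<open>Riesz representation in finite dimension: the gradient has the values of
  \<open>f'\<close> on \<open>Basis\<close> as its coordinates. This provides the witness for the
  choice made in \<open>gradient_within\<close>.\<close>

lemma has_derivative_imp_gradient:
  fixes f :: "'b::euclidean_space \<Rightarrow> real"
  assumes "(f has_derivative f') F"
  shows "f' = (\<lambda>h. (\<Sum>b\<in>Basis. f' b *\<^sub>R b) \<bullet> h)"
proof
  fix h
  have "linear f'"
    using assms has_derivative_linear by blast
  then have "f' h = (\<Sum>b\<in>Basis. (h \<bullet> b) * f' b)"
    using Linear_Algebra.linear_componentwise[of f' h 1] by simp
  then show "f' h = (\<Sum>b\<in>Basis. f' b *\<^sub>R b) \<bullet> h"
    by (simp add: inner_commute[of _ h] inner_sum_right mult.commute)
qed

lemma gradient_within_derivative: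
  assumes "f differentiable_on S" "z \<in> S"
  shows "(f has_derivative (\<lambda>h. gradient_within S f z \<bullet> h)) (at z within S)"
proof -
  obtain f' where f': "(f has_derivative f') (at z within S)"
    using assms by (auto simp: differentiable_on_def differentiable_def)
  from has_derivative_imp_gradient[OF f'] f'
  have "\<exists>g. (f has_derivative (\<lambda>h. g \<bullet> h)) (at z within S)"
    by metis
  then show ?thesis
    unfolding gradient_within_def by (rule someI_ex)
qed

text \<open>On a domain with empty interior the gradient is only one of many choices. Its product
  with \<open>z1 - z2\<close> is nevertheless a one-sided derivative in one real variable, where
  limits are unique, so later arguments work with this derivative instead of the gradient.\<close>

lemma has_field_derivative_along_segment:
  fixes f :: "'b::ordered_euclidean_space \<Rightarrow> real"
  assumes "convex S" "f differentiable_on S" "z1 \<in> S" "z2 \<in> S"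
  shows "((\<lambda>t. f (z2 + t *\<^sub>R (z1 - z2))) has_field_derivative
    gradient_within S f z2 \<bullet> (z1 - z2)) (at 0 within {0..1::real})"
proof -
  let ?l = "\<lambda>t::real. z2 + t *\<^sub>R (z1 - z2)"
  have l: "?l ` {0..1} \<subseteq> S"
  proof
    fix x assume "x \<in> ?l ` {0..1}"
    then obtain t where "0 \<le> t" "t \<le> 1" "x = (1 - t) *\<^sub>R z2 + t *\<^sub>R z1"
      by (auto simp: algebra_simps)
    then show "x \<in> S"
      using assms convexD_alt by blast
  qed
  have "(f has_derivative (\<lambda>h. gradient_within S f z2 \<bullet> h)) (at (?l 0) within ?l ` {0..1})"
    using has_derivative_subset[OF gradient_within_derivative[OF assms(2,4)] l] by simp
  moreover have "(?l has_derivative (\<lambda>t. t *\<^sub>R (z1 - z2))) (at 0 within {0..1})"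
    by (auto intro!: derivative_eq_intros)
  ultimately have "((\<lambda>t. f (?l t)) has_derivative (\<lambda>t. gradient_within S f z2 \<bullet> (t *\<^sub>R (z1 - z2))))
      (at 0 within {0..1})"
    by (rule has_derivative_in_compose[rotated])
  then show ?thesis
    by (simp add: has_field_derivative_def mult.commute[of _ "gradient_within S f z2 \<bullet> _"])
qed

text \<open>By convexity every difference quotient \<open>?q t\<close> along the segment from
  \<open>y\<close> to \<open>x\<close> is at most \<open>f x - f y\<close>; the limit at 0 is the
  gradient term and inherits the bound.\<close>

lemma bregman_nonneg:
  assumes "bregman_generator S f" "x \<in> S" "y \<in> S"
  shows "0 \<le> bregman S f x y"
proof -
  have c: "convex_on S f" "convex S" and d: "f differentiable_on S"
    using assms by (auto simp: bregman_generator_def convex_on_imp_convex)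
  let ?q = "\<lambda>t::real. (f (y + t *\<^sub>R (x - y)) - f y) / t"
  have "((\<lambda>t. f (y + t *\<^sub>R (x - y))) has_field_derivative gradient_within S f y \<bullet> (x - y))
      (at 0 within {0..1})"
    using c d assms by (intro has_field_derivative_along_segment)
  then have lim: "(?q \<longlongrightarrow> gradient_within S f y \<bullet> (x - y)) (at 0 within {0..1})"
    by (simp add: has_field_derivative_iff)
  have "?q t \<le> f x - f y" if t: "t \<in> {0..1}" "t \<noteq> 0" for t
  proof -
    have "f ((1 - t) *\<^sub>R y + t *\<^sub>R x) \<le> (1 - t) * f y + t * f x"
      using t c assms by (intro convex_onD) auto
    then have "f (y + t *\<^sub>R (x - y)) - f y \<le> (f x - f y) * t"
      by (simp add: algebra_simps)
    then show ?thesis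
      using t by (simp add: pos_divide_le_eq)
  qed
  then have "eventually (\<lambda>t. ?q t \<le> f x - f y) (at 0 within {0..1})"
    by (simp add: eventually_at_filter)
  then have "gradient_within S f y \<bullet> (x - y) \<le> f x - f y"
    using lim by (intro tendsto_upperbound) (auto simp: trivial_limit_within islimpt_Icc)
  then show ?thesis
    by (simp add: bregman_def)
qed

text \<open>Only the gradient terms need an argument: both are derivatives at 0 of the same function
  of \<open>t\<close> on the segment from \<open>y\<close> to \<open>x\<close>, so uniqueness of the
  derivative identifies them.\<close>

lemma bregman_separable:
  fixes \<Phi> :: "real ^ 'n \<Rightarrow> real" and \<phi> :: "'n \<Rightarrow> real \<Rightarrow> real"
  assumes "convex D" "bregman_generator (power_domain D) \<Phi>"
    and gen: "\<And>k. bregman_generator D (\<phi> k)"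
    and sep: "\<And>x. x \<in> power_domain D \<Longrightarrow> \<Phi> x = (\<Sum>k\<in>UNIV. \<phi> k (x $ k))"
    and x: "x \<in> power_domain D" and y: "y \<in> power_domain D"
  shows "bregman (power_domain D) \<Phi> x y = (\<Sum>k\<in>UNIV. bregman D (\<phi> k) (x $ k) (y $ k))"
proof -
  let ?S = "power_domain D :: (real ^ 'n) set"
  have cS: "convex ?S"
    using assms(2) convex_on_imp_convex by (auto simp: bregman_generator_def)
  let ?l = "\<lambda>t::real. y + t *\<^sub>R (x - y)"
  have l: "?l t \<in> ?S" if "t \<in> {0..1}" for t
    using convexD_alt[OF cS y x, of t] that by (simp add: algebra_simps)
  have "((\<lambda>t. \<Phi> (?l t)) has_field_derivative gradient_within ?S \<Phi> y \<bullet> (x - y)) (at 0 within {0..1})"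
    using assms cS by (intro has_field_derivative_along_segment) (auto simp: bregman_generator_def)
  then have "((\<lambda>t. \<Sum>k\<in>UNIV. \<phi> k (y $ k + t *\<^sub>R (x $ k - y $ k))) has_field_derivative
      gradient_within ?S \<Phi> y \<bullet> (x - y)) (at 0 within {0..1})"
    \<comment> \<open>The separable form is available on \<open>power_domain D\<close> only, and the
      segment lies there for \<open>t\<close> in \<open>{0..1}\<close>; the derivative is taken
      within that interval.\<close>
    by (rule has_field_derivative_transform_within[where d=1]) (auto simp: sep l)
  moreover have "((\<lambda>t. \<Sum>k\<in>UNIV. \<phi> k (y $ k + t *\<^sub>R (x $ k - y $ k))) has_field_derivative
      (\<Sum>k\<in>UNIV. gradient_within D (\<phi> k) (y $ k) \<bullet> (x $ k - y $ k))) (at 0 within {0..1})"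
    using assms
    by (intro DERIV_sum has_field_derivative_along_segment)
       (auto simp: bregman_generator_def power_domain_def)
  ultimately have "gradient_within ?S \<Phi> y \<bullet> (x - y)
      = (\<Sum>k\<in>UNIV. gradient_within D (\<phi> k) (y $ k) \<bullet> (x $ k - y $ k))"
    by (rule has_field_derivative_unique) (auto simp: trivial_limit_within islimpt_Icc)
  then show ?thesis
    by (simp add: bregman_def sep x y sum_subtractf)
qed

section \<open>Monotone derivatives in one variable\<close>

text \<open>Adding the two divergences between \<open>x\<close> and \<open>y\<close> cancels the
  values of \<open>f\<close> and leaves the product of the increments of derivative and argument,
  which is therefore nonnegative.\<close>

lemma gradient_within_mono:
  fixes f :: "real \<Rightarrow> real"
  assumes "bregman_generator D f"
  shows "mono_on D (gradient_within D f)"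
proof (rule mono_onI)
  fix x y assume xy: "x \<in> D" "y \<in> D" "x \<le> y"
  have "0 \<le> bregman D f x y + bregman D f y x"
    using bregman_nonneg[OF assms] xy by (intro add_nonneg_nonneg) auto
  also have "\<dots> = (gradient_within D f y - gradient_within D f x) * (y - x)"
    by (simp add: bregman_def algebra_simps)
  finally show "gradient_within D f x \<le> gradient_within D f y"
    using xy by (cases "x = y") (auto simp: zero_le_mult_iff)
qed

lemma borel_convex_real: "convex D \<Longrightarrow> D \<in> sets (borel :: real measure)"
  by (simp only: real_interval_borel_measurable is_interval_convex_1)

text \<open>Monotone functions are Borel. The value 0 off \<open>D\<close> is arbitrary, since
  layers will evaluate the derivative at points of \<open>D\<close> only.\<close>

lemma gradient_extension_measurable:
  assumes "bregman_generator D f"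
  shows "(\<lambda>x. if x \<in> D then gradient_within D f x else 0) \<in> borel_measurable (borel :: real measure)"
proof -
  have "D \<in> sets borel"
    using assms by (auto simp: bregman_generator_def intro!: borel_convex_real convex_on_imp_convex)
  then show ?thesis
    using borel_measurable_mono_on_fnc[OF gradient_within_mono[OF assms]]
    by (subst (asm) measurable_restrict_space_iff[where c=0]) auto
qed

section \<open>Layer decomposition of the divergence\<close>

text \<open>For \<open>x\<close>, \<open>y\<close> in \<open>D\<close> and \<open>d\<close> monotone
  on \<open>D\<close>, this is the region between the graph of \<open>d\<close> and the height
  \<open>d y\<close>, over the \<open>t\<close> between \<open>y\<close> and \<open>x\<close>. The
  bound on \<open>t\<close> from the side of \<open>y\<close> is left out because monotonicity
  forces it. Thus, for fixed \<open>(t, s)\<close>, the condition splits into one on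
  \<open>x\<close> and one on \<open>y\<close>.\<close>

definition layer :: "real set \<Rightarrow> (real \<Rightarrow> real) \<Rightarrow> real \<Rightarrow> real \<Rightarrow> real \<Rightarrow> real \<Rightarrow> bool" where
  "layer D d x y t s \<longleftrightarrow>
    t \<in> D \<and> (if t < x then d y < s \<and> s \<le> d t else d t < s \<and> s \<le> d y)"

lemma nn_integral_Ioc: "(\<integral>\<^sup>+s. indicator {a<..b} s \<partial>lborel) = ennreal (b - a)"
  by (cases "a \<le> b") (auto simp: ennreal_neg)

text \<open>The inner integral is the height of the region above \<open>t\<close>, and the
  fundamental theorem of calculus for the gauge integral turns the integral of
  \<open>d t - d y\<close> into the divergence. Since the integrand has constant sign on the
  interval, gauge and Lebesgue integrals agree.\<close>

lemma bregman_layers: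
  fixes f :: "real \<Rightarrow> real"
  assumes f: "bregman_generator D f" and x: "x \<in> D" and y: "y \<in> D"
    and d: "\<And>t. t \<in> D \<Longrightarrow> d t = gradient_within D f t"
  shows "ennreal (bregman D f x y) =
    (\<integral>\<^sup>+t. \<integral>\<^sup>+s. indicator {s. layer D d x y t s} s \<partial>lborel \<partial>lborel)"
proof -
  have cD: "convex D" and diff: "f differentiable_on D"
    using f by (auto simp: bregman_generator_def convex_on_imp_convex)
  have mono: "d s \<le> d t" if "s \<in> D" "t \<in> D" "s \<le> t" for s t
    using gradient_within_mono[OF f] that d by (auto simp: mono_on_def)
  have sub: "{a..b} \<subseteq> D" if "a \<in> D" "b \<in> D" for a b
    using cD that mem_is_interval_1_I[of D a b] unfolding is_interval_convex_1[symmetric] by auto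
  have ftc: "((\<lambda>t. d t - c) has_integral (f b - f a - c * (b - a))) {a..b}"
    if ab: "a \<in> D" "b \<in> D" "a \<le> b" for a b c
  proof -
    have "((\<lambda>t. d t - c) has_integral ((f b - c * b) - (f a - c * a))) {a..b}"
    proof (rule fundamental_theorem_of_calculus[OF ab(3)])
      fix t assume "t \<in> {a..b}"
      then have t: "t \<in> D" using sub ab by blast
      have "(f has_derivative (\<lambda>h. d t * h)) (at t within {a..b})"
        using has_derivative_subset[OF gradient_within_derivative[OF diff t] sub[OF ab(1,2)]] d[OF t]
        by simp
      then show "((\<lambda>x. f x - c * x) has_vector_derivative d t - c) (at t within {a..b})"
        unfolding has_vector_derivative_def
        by (auto intro!: derivative_eq_intros simp: algebra_simps)
    qed
    then show ?thesis by (simp add: algebra_simps)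
  qed
  have inner: "(\<integral>\<^sup>+s. indicator {s. layer D d x y t s} s \<partial>lborel) =
      (if t \<in> D then if t < x then ennreal (d t - d y) else ennreal (d y - d t) else 0)" for t
  proof -
    have "{s. layer D d x y t s} =
        (if t \<in> D then if t < x then {d y<..d t} else {d t<..d y} else {})"
      by (auto simp: layer_def)
    then show ?thesis by (simp add: nn_integral_Ioc del: nn_integral_indicator)
  qed
  have "(\<integral>\<^sup>+t. \<integral>\<^sup>+s. indicator {s. layer D d x y t s} s \<partial>lborel \<partial>lborel) = ennreal (bregman D f x y)"
  proof (cases "y \<le> x")
    case True
    have "(\<integral>\<^sup>+t. \<integral>\<^sup>+s. indicator {s. layer D d x y t s} s \<partial>lborel \<partial>lborel) =
        (\<integral>\<^sup>+t. ennreal (d t - d y) * indicator {y..x} t \<partial>lborel)"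
    proof (rule nn_integral_cong_AE)
      show "AE t in lborel. (\<integral>\<^sup>+s. indicator {s. layer D d x y t s} s \<partial>lborel)
          = ennreal (d t - d y) * indicator {y..x} t"
        \<comment> \<open>At \<open>t = x\<close> the definition of \<open>layer\<close> already
          takes its second branch, so the two integrands may differ at this point.\<close>
        using AE_lborel_singleton[of x]
      proof eventually_elim
        case (elim t)
        have "t \<in> D" if "y \<le> t" "t \<le> x" using sub[OF y x] that by auto
        \<comment> \<open>Outside the interval, monotonicity makes the difference nonpositive and
          \<open>ennreal\<close> sends it to 0.\<close>
        with elim mono[of t y] mono[of y t] x y True show ?case
          unfolding inner by (auto simp: indicator_def ennreal_neg)
      qed
    qed
    also have "\<dots> = ennreal (f x - f y - d y * (x - y))"
      using ftc[OF y x True] mono[OF y] sub[OF y x]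
      by (intro nn_integral_has_integral_lebesgue') auto
    finally show ?thesis
      using d y by (simp add: bregman_def)
  next
    case False
    have "(\<integral>\<^sup>+t. \<integral>\<^sup>+s. indicator {s. layer D d x y t s} s \<partial>lborel \<partial>lborel) =
        (\<integral>\<^sup>+t. ennreal (d y - d t) * indicator {x..y} t \<partial>lborel)"
    proof (rule nn_integral_cong)
      fix t
      have "t \<in> D" if "x \<le> t" "t \<le> y" using sub[OF x y] that by auto
      with mono[of t y] mono[of y t] x y False
      show "(\<integral>\<^sup>+s. indicator {s. layer D d x y t s} s \<partial>lborel)
          = ennreal (d y - d t) * indicator {x..y} t"
        unfolding inner by (auto simp: indicator_def ennreal_neg)
    qed
    also have "\<dots> = ennreal (- (f y - f x - d y * (y - x)))"
      using has_integral_neg[OF ftc[OF x y, of "d y"]] mono[OF _ y] sub[OF x y] False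
      by (intro nn_integral_has_integral_lebesgue') auto
    finally show ?thesis
      using d y by (simp add: bregman_def algebra_simps)
  qed
  then show ?thesis by simp
qed

lemma layer_measurable:
  assumes [measurable]: "D \<in> sets borel" "d \<in> borel_measurable borel"
    "U \<in> borel_measurable M" "V \<in> borel_measurable M"
  shows "(\<lambda>((\<omega>, t), s). indicator {s. layer D d (U \<omega>) (V \<omega>) t s} s :: ennreal)
    \<in> borel_measurable ((M \<Otimes>\<^sub>M lborel) \<Otimes>\<^sub>M lborel)"
proof -
  have "(\<lambda>p. if layer D d (U (fst (fst p))) (V (fst (fst p))) (snd (fst p)) (snd p) then 1 else 0 :: ennreal)
      \<in> borel_measurable ((M \<Otimes>\<^sub>M lborel) \<Otimes>\<^sub>M lborel)"
    unfolding layer_def by measurable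
  then show ?thesis
    by (simp add: split_beta' indicator_def of_bool_def)
qed

text \<open>Two applications of Tonelli carry the integral over \<open>M\<close> innermost, where it
  becomes the measure of an event. Measurability of the divergence comes from the same iterated
  integral.\<close>

lemma nn_integral_bregman_layers:
  assumes M: "sigma_finite_measure M"
    and f: "bregman_generator D f" and U: "U \<in> random_vectors M D" and V: "V \<in> random_vectors M D"
    and d: "\<And>t. t \<in> D \<Longrightarrow> d t = gradient_within D f t" and dm: "d \<in> borel_measurable borel"
  shows "(\<lambda>\<omega>. ennreal (bregman D f (U \<omega>) (V \<omega>))) \<in> borel_measurable M"
    and "(\<integral>\<^sup>+\<omega>. ennreal (bregman D f (U \<omega>) (V \<omega>)) \<partial>M) =
      (\<integral>\<^sup>+t. \<integral>\<^sup>+s. emeasure M {\<omega>\<in>space M. layer D d (U \<omega>) (V \<omega>) t s} \<partial>lborel \<partial>lborel)"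
proof -
  interpret sigma_finite_measure M by fact
  have [measurable]: "D \<in> sets borel"
    using f by (auto simp: bregman_generator_def intro!: borel_convex_real convex_on_imp_convex)
  have [measurable]: "U \<in> borel_measurable M" "V \<in> borel_measurable M"
    using U V by (auto simp: random_vectors_def)
  note [measurable] = dm
  let ?k = "\<lambda>\<omega> t s. indicator {s. layer D d (U \<omega>) (V \<omega>) t s} s :: ennreal"
  have k3[measurable]: "(\<lambda>((\<omega>, t), s). ?k \<omega> t s) \<in> borel_measurable ((M \<Otimes>\<^sub>M lborel) \<Otimes>\<^sub>M lborel)"
    by (rule layer_measurable) auto
  have k2: "(\<lambda>(\<omega>, t). \<integral>\<^sup>+s. ?k \<omega> t s \<partial>lborel) \<in> borel_measurable (M \<Otimes>\<^sub>M lborel)"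
    using lborel.borel_measurable_nn_integral_fst[OF k3] by (simp add: split_beta')
  have k1: "(\<lambda>\<omega>. \<integral>\<^sup>+t. \<integral>\<^sup>+s. ?k \<omega> t s \<partial>lborel \<partial>lborel) \<in> borel_measurable M"
    using lborel.borel_measurable_nn_integral_fst[OF k2] by simp
  have eq: "ennreal (bregman D f (U \<omega>) (V \<omega>)) = (\<integral>\<^sup>+t. \<integral>\<^sup>+s. ?k \<omega> t s \<partial>lborel \<partial>lborel)"
    if "\<omega> \<in> space M" for \<omega>
    using that U V by (intro bregman_layers f d) (auto simp: random_vectors_def)
  show "(\<lambda>\<omega>. ennreal (bregman D f (U \<omega>) (V \<omega>))) \<in> borel_measurable M"
    using k1 by (subst measurable_cong[OF eq]) auto
  interpret P: pair_sigma_finite M "lborel :: real measure" ..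
  have "(\<integral>\<^sup>+\<omega>. ennreal (bregman D f (U \<omega>) (V \<omega>)) \<partial>M)
      = (\<integral>\<^sup>+\<omega>. \<integral>\<^sup>+t. \<integral>\<^sup>+s. ?k \<omega> t s \<partial>lborel \<partial>lborel \<partial>M)"
    by (rule nn_integral_cong) (rule eq)
  also have "\<dots> = (\<integral>\<^sup>+t. \<integral>\<^sup>+\<omega>. \<integral>\<^sup>+s. ?k \<omega> t s \<partial>lborel \<partial>M \<partial>lborel)"
    by (rule P.Fubini'[symmetric]) (rule k2)
  also have "\<dots> = (\<integral>\<^sup>+t. \<integral>\<^sup>+s. \<integral>\<^sup>+\<omega>. ?k \<omega> t s \<partial>M \<partial>lborel \<partial>lborel)"
  proof (rule nn_integral_cong, rule P.Fubini'[symmetric])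
    fix t :: real
    \<comment> \<open>Freezing \<open>t\<close> turns the jointly measurable kernel into one in
      \<open>(\<omega>, s)\<close>, as the second exchange requires.\<close>
    have "(\<lambda>(\<omega>, s). ((\<omega>, t), s)) \<in> M \<Otimes>\<^sub>M lborel \<rightarrow>\<^sub>M (M \<Otimes>\<^sub>M lborel) \<Otimes>\<^sub>M (lborel :: real measure)"
      by measurable
    from measurable_compose[OF this k3]
    show "(\<lambda>(\<omega>, s). ?k \<omega> t s) \<in> borel_measurable (M \<Otimes>\<^sub>M lborel)"
      by (simp add: split_beta')
  qed
  also have "\<dots> = (\<integral>\<^sup>+t. \<integral>\<^sup>+s. emeasure M {\<omega>\<in>space M. layer D d (U \<omega>) (V \<omega>) t s} \<partial>lborel \<partial>lborel)"
  proof (intro nn_integral_cong)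
    fix t s :: real
    have "{\<omega>\<in>space M. layer D d (U \<omega>) (V \<omega>) t s} \<in> sets M"
      unfolding layer_def by measurable
    then have "emeasure M {\<omega>\<in>space M. layer D d (U \<omega>) (V \<omega>) t s}
        = (\<integral>\<^sup>+\<omega>. indicator {\<omega>\<in>space M. layer D d (U \<omega>) (V \<omega>) t s} \<omega> \<partial>M)"
      by simp
    also have "\<dots> = (\<integral>\<^sup>+\<omega>. ?k \<omega> t s \<partial>M)"
      by (rule nn_integral_cong) (auto simp: indicator_def)
    finally show "(\<integral>\<^sup>+\<omega>. ?k \<omega> t s \<partial>M) = emeasure M {\<omega>\<in>space M. layer D d (U \<omega>) (V \<omega>) t s}"
      by simp
  qed
  finally show "(\<integral>\<^sup>+\<omega>. ennreal (bregman D f (U \<omega>) (V \<omega>)) \<partial>M) =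
      (\<integral>\<^sup>+t. \<integral>\<^sup>+s. emeasure M {\<omega>\<in>space M. layer D d (U \<omega>) (V \<omega>) t s} \<partial>lborel \<partial>lborel)" .
qed

lemma (in prob_space) bregman_measurable:
  fixes f :: "real \<Rightarrow> real"
  assumes "bregman_generator D f" "U \<in> random_vectors M D" "V \<in> random_vectors M D"
  shows "(\<lambda>\<omega>. ennreal (bregman D f (U \<omega>) (V \<omega>))) \<in> borel_measurable M"
  by (rule nn_integral_bregman_layers(1)[OF _ assms _ gradient_extension_measurable[OF assms(1)]])
     (auto simp: sigma_finite_measure_axioms)

section \<open>Extremal events under comonotonicity\<close>

text \<open>The lower Frechet bound: given the marginal probabilities, an intersection has
  probability at least \<open>max 0 (prob A + prob B - 1)\<close>. The two alternatives in
  \<open>ext\<close> are the cases of equality.\<close>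

lemma (in prob_space) prob_Int_le_of_extremal:
  assumes [measurable]: "A \<in> events" "B \<in> events" "A' \<in> events" "B' \<in> events"
    and eq: "prob A = prob A'" "prob B = prob B'"
    and ext: "(AE \<omega> in M. \<omega> \<notin> A \<inter> B) \<or> (AE \<omega> in M. \<omega> \<in> A \<union> B)"
  shows "prob (A \<inter> B) \<le> prob (A' \<inter> B')"
  using ext
proof
  assume "AE \<omega> in M. \<omega> \<notin> A \<inter> B"
  then have "prob (A \<inter> B) = 0"
    by (subst prob_eq_0) auto
  then show ?thesis by simp
next
  assume "AE \<omega> in M. \<omega> \<in> A \<union> B"
  then have "prob (A \<union> B) = 1"
    by (subst prob_eq_1) auto
  moreover have "prob (A \<union> B) = prob A + prob B - prob (A \<inter> B)"
    "prob (A' \<union> B') = prob A' + prob B' - prob (A' \<inter> B')"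
    by (auto intro!: measure_Un3 fmeasurableI simp: less_top[symmetric])
  ultimately show ?thesis
    using eq prob_le_1[of "A' \<union> B'"] by linarith
qed

lemma (in prob_space) distr_eq_imp_prob_eq:
  assumes "distr M borel X = distr M borel Y"
    and [measurable]: "X \<in> borel_measurable M" "Y \<in> borel_measurable M" "Measurable.pred borel P"
  shows "prob {\<omega>\<in>space M. P (X \<omega>)} = prob {\<omega>\<in>space M. P (Y \<omega>)}"
proof -
  have "prob {\<omega>\<in>space M. P (X \<omega>)} = measure (distr M borel X) {x. P x}"
    if [measurable]: "X \<in> borel_measurable M" for X
    by (subst measure_distr) (auto simp: vimage_def Int_def conj_commute)
  then show ?thesis
    using assms by simp
qed

text \<open>If both alternatives failed, the set of full measure would contain a point satisfying
  \<open>P\<close> and \<open>Q\<close> and a point satisfying neither, a pair that comonotonicity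
  excludes.\<close>

lemma (in prob_space) comonotonic_AE_cases:
  assumes co: "comonotonic M X Y"
    and Q: "\<And>\<omega> \<omega>'. P \<omega> \<Longrightarrow> Q \<omega> \<Longrightarrow> \<not> P \<omega>' \<Longrightarrow> \<not> Q \<omega>' \<Longrightarrow> \<omega> \<in> space M \<Longrightarrow> \<omega>' \<in> space M \<Longrightarrow>
      (X \<omega> - X \<omega>') * (Y \<omega> - Y \<omega>') < 0"
  shows "(AE \<omega> in M. \<not> (P \<omega> \<and> Q \<omega>)) \<or> (AE \<omega> in M. P \<omega> \<or> Q \<omega>)"
proof -
  obtain \<Omega>0 where \<Omega>0: "\<Omega>0 \<in> events" "prob \<Omega>0 = 1"
    and nn: "\<And>\<omega> \<omega>'. \<omega> \<in> \<Omega>0 \<Longrightarrow> \<omega>' \<in> \<Omega>0 \<Longrightarrow> 0 \<le> (X \<omega> - X \<omega>') * (Y \<omega> - Y \<omega>')"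
    using co by (auto simp: comonotonic_def)
  have ae: "AE \<omega> in M. \<omega> \<in> \<Omega>0"
    using \<Omega>0 by (simp add: prob_eq_1)
  have sp: "\<Omega>0 \<subseteq> space M"
    using \<Omega>0 sets.sets_into_space by blast
  have "(\<forall>\<omega>\<in>\<Omega>0. \<not> (P \<omega> \<and> Q \<omega>)) \<or> (\<forall>\<omega>\<in>\<Omega>0. P \<omega> \<or> Q \<omega>)"
    using nn Q sp by (meson linorder_not_less subset_iff)
  then show ?thesis
    using AE_mp[OF ae, of "\<lambda>\<omega>. \<not> (P \<omega> \<and> Q \<omega>)"] AE_mp[OF ae, of "\<lambda>\<omega>. P \<omega> \<or> Q \<omega>"]
    by (elim disjE) auto
qed

text \<open>A layer event asks one variable to be large and the other to be small. Comonotonicity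
  makes such a pair of events extremal, and \<open>U\<close>, \<open>V\<close> give events with the
  same marginal probabilities.\<close>

lemma (in prob_space) comonotonic_layer_le:
  assumes co: "comonotonic M Z X"
    and rv: "Z \<in> random_vectors M D" "X \<in> random_vectors M D"
      "U \<in> random_vectors M D" "V \<in> random_vectors M D"
    and eq: "distr M borel Z = distr M borel U" "distr M borel X = distr M borel V"
    and mono: "mono_on D d" and [measurable]: "d \<in> borel_measurable borel"
  shows "emeasure M {\<omega>\<in>space M. layer D d (Z \<omega>) (X \<omega>) t s}
    \<le> emeasure M {\<omega>\<in>space M. layer D d (U \<omega>) (V \<omega>) t s}"
proof -
  have [measurable]: "Z \<in> borel_measurable M" "X \<in> borel_measurable M"
     "U \<in> borel_measurable M" "V \<in> borel_measurable M"
    using rv by (auto simp: random_vectors_def)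
  \<comment> \<open>A monotone \<open>d\<close> may be constant on intervals, but strict inequality
    of its values still yields strict inequality of the arguments, hence a strictly negative product
    below.\<close>
  have less: "X \<omega> < X \<omega>'" if "d (X \<omega>) < d (X \<omega>')" "\<omega> \<in> space M" "\<omega>' \<in> space M" for \<omega> \<omega>'
    using mono rv that by (force simp: mono_on_def random_vectors_def not_le[symmetric])
  have *: "prob ({\<omega>\<in>space M. P (Z \<omega>)} \<inter> {\<omega>\<in>space M. Q (X \<omega>)})
      \<le> prob ({\<omega>\<in>space M. P (U \<omega>)} \<inter> {\<omega>\<in>space M. Q (V \<omega>)})"
    if [measurable]: "Measurable.pred borel P" "Measurable.pred borel Q"
      and neg: "\<And>\<omega> \<omega>'. P (Z \<omega>) \<Longrightarrow> Q (X \<omega>) \<Longrightarrow> \<not> P (Z \<omega>') \<Longrightarrow> \<not> Q (X \<omega>') \<Longrightarrow>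
        \<omega> \<in> space M \<Longrightarrow> \<omega>' \<in> space M \<Longrightarrow> (Z \<omega> - Z \<omega>') * (X \<omega> - X \<omega>') < 0"
    for P Q
  proof (rule prob_Int_le_of_extremal)
    show "prob {\<omega>\<in>space M. P (Z \<omega>)} = prob {\<omega>\<in>space M. P (U \<omega>)}"
      "prob {\<omega>\<in>space M. Q (X \<omega>)} = prob {\<omega>\<in>space M. Q (V \<omega>)}"
      by (intro distr_eq_imp_prob_eq eq; measurable)+
    show "(AE \<omega> in M. \<omega> \<notin> {\<omega>\<in>space M. P (Z \<omega>)} \<inter> {\<omega>\<in>space M. Q (X \<omega>)}) \<or>
        (AE \<omega> in M. \<omega> \<in> {\<omega>\<in>space M. P (Z \<omega>)} \<union> {\<omega>\<in>space M. Q (X \<omega>)})"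
      using comonotonic_AE_cases[OF co, of "\<lambda>\<omega>. P (Z \<omega>)" "\<lambda>\<omega>. Q (X \<omega>)"] neg
      by (auto elim!: AE_mp)
  qed measurable
  \<comment> \<open>Comparing \<open>s\<close> with \<open>d t\<close> leaves just one branch of
    \<open>layer\<close> possible, so the event becomes an intersection.\<close>
  consider "t \<notin> D" | "t \<in> D" "s \<le> d t" | "t \<in> D" "d t < s"
    by linarith
  then show ?thesis
  proof cases
    case 1
    then show ?thesis by (simp add: layer_def)
  next
    case 2
    then have "{\<omega>\<in>space M. layer D d (A \<omega>) (B \<omega>) t s}
        = {\<omega>\<in>space M. t < A \<omega>} \<inter> {\<omega>\<in>space M. d (B \<omega>) < s}" for A B
      by (auto simp: layer_def)
    moreover have "prob ({\<omega>\<in>space M. t < Z \<omega>} \<inter> {\<omega>\<in>space M. d (X \<omega>) < s})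
        \<le> prob ({\<omega>\<in>space M. t < U \<omega>} \<inter> {\<omega>\<in>space M. d (V \<omega>) < s})"
      by (rule *) (auto intro!: mult_pos_neg less)
    ultimately show ?thesis
      by (simp add: emeasure_eq_measure)
  next
    case 3
    then have "{\<omega>\<in>space M. layer D d (A \<omega>) (B \<omega>) t s}
        = {\<omega>\<in>space M. A \<omega> \<le> t} \<inter> {\<omega>\<in>space M. s \<le> d (B \<omega>)}" for A B
      by (auto simp: layer_def)
    moreover have "prob ({\<omega>\<in>space M. Z \<omega> \<le> t} \<inter> {\<omega>\<in>space M. s \<le> d (X \<omega>)})
        \<le> prob ({\<omega>\<in>space M. U \<omega> \<le> t} \<inter> {\<omega>\<in>space M. s \<le> d (V \<omega>)})"
      by (rule *) (auto intro!: mult_neg_pos less)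
    ultimately show ?thesis
      by (simp add: emeasure_eq_measure)
  qed
qed

section \<open>Distribution functions determine laws\<close>

text \<open>The lower orthants generate the Borel sets, are closed under intersection through the
  componentwise \<open>inf\<close>, and exhaust the space along multiples of
  \<open>One\<close>.\<close>

lemma (in prob_space) rv_cdf_eq_imp_distr_eq:
  fixes X Y :: "'a \<Rightarrow> 'b::ordered_euclidean_space"
  assumes [measurable]: "X \<in> borel_measurable M" "Y \<in> borel_measurable M"
    and eq: "rv_cdf M X = rv_cdf M Y"
  shows "distr M borel X = distr M borel Y"
proof -
  interpret X: prob_space "distr M borel X" by (rule prob_space_distr) measurable
  interpret Y: prob_space "distr M borel Y" by (rule prob_space_distr) measurable
  let ?E = "range (\<lambda>a::'b. {..a})"
  have S: "sets borel = sigma_sets UNIV ?E"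
    by (subst borel_eq_atMost) simp
  show ?thesis
  proof (rule measure_eqI_generator_eq)
    show "Int_stable ?E"
    proof (clarsimp simp: Int_stable_def)
      fix a b :: 'b
      have "{..a} \<inter> {..b} = {..inf a b}"
        by (auto simp: eucl_le[where 'a='b] inner_Basis_inf_left)
      then show "{..a} \<inter> {..b} \<in> ?E"
        by blast
    qed
    show "emeasure (distr M borel X) A = emeasure (distr M borel Y) A" if "A \<in> ?E" for A
      using that eq
      by (auto simp: X.emeasure_eq_measure Y.emeasure_eq_measure rv_cdf_def fun_eq_iff)
    show "range (\<lambda>n::nat. {..real n *\<^sub>R (One :: 'b)}) \<subseteq> ?E"
      by auto
    show "(\<Union>n::nat. {..real n *\<^sub>R (One :: 'b)}) = UNIV"
    proof safe
      fix x :: 'b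
      obtain n :: nat where "Max ((\<bullet>) x ` Basis) \<le> real n"
        using real_arch_simple by blast
      then have "x \<le> real n *\<^sub>R One"
        by (subst (asm) Max_le_iff) (auto simp: eucl_le[where 'a='b])
      then show "x \<in> (\<Union>n::nat. {..real n *\<^sub>R (One :: 'b)})"
        by auto
    qed auto
  qed (auto simp: S X.emeasure_eq_measure)
qed

section \<open>Optimal couplings and projection to components\<close>

lemma BW_div_le_coupling:
  assumes "U \<in> random_vectors M S" "V \<in> random_vectors M S"
  shows "BW_div M S f (rv_cdf M U) (rv_cdf M V) \<le> (\<integral>\<^sup>+\<omega>. ennreal (bregman S f (U \<omega>) (V \<omega>)) \<partial>M)"
  unfolding BW_div_def using assms
  by (intro INF_lower2[of "(U, V)"]) (auto simp: couplings_def)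

text \<open>The cost of any competing coupling dominates layer by layer, before integration over
  \<open>(t, s)\<close>, so infinite costs are covered as well.\<close>

lemma (in prob_space) BW_div_comonotonic:
  fixes f :: "real \<Rightarrow> real"
  assumes f: "bregman_generator D f" and co: "comonotonic M Z X"
    and Z: "Z \<in> random_vectors M D" and X: "X \<in> random_vectors M D"
  shows "BW_div_rv M D f Z X = (\<integral>\<^sup>+\<omega>. ennreal (bregman D f (Z \<omega>) (X \<omega>)) \<partial>M)"
proof (rule antisym)
  show "BW_div_rv M D f Z X \<le> (\<integral>\<^sup>+\<omega>. ennreal (bregman D f (Z \<omega>) (X \<omega>)) \<partial>M)"
    unfolding BW_div_rv_def using Z X by (rule BW_div_le_coupling)
  let ?d = "\<lambda>x. if x \<in> D then gradient_within D f x else 0"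
  have dm: "?d \<in> borel_measurable borel"
    using f by (rule gradient_extension_measurable)
  have mono: "mono_on D ?d"
    using gradient_within_mono[OF f] by (simp add: mono_on_def)
  show "(\<integral>\<^sup>+\<omega>. ennreal (bregman D f (Z \<omega>) (X \<omega>)) \<partial>M) \<le> BW_div_rv M D f Z X"
    unfolding BW_div_rv_def BW_div_def
  proof (rule INF_greatest, clarify)
    fix U V assume "(U, V) \<in> couplings M D (rv_cdf M Z) (rv_cdf M X)"
    then have U: "U \<in> random_vectors M D" and V: "V \<in> random_vectors M D"
      and eq: "rv_cdf M Z = rv_cdf M U" "rv_cdf M X = rv_cdf M V"
      by (auto simp: couplings_def)
    have "distr M borel Z = distr M borel U" "distr M borel X = distr M borel V"
      using U V Z X eq by (auto intro!: rv_cdf_eq_imp_distr_eq simp: random_vectors_def)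
    then have "(\<integral>\<^sup>+t. \<integral>\<^sup>+s. emeasure M {\<omega>\<in>space M. layer D ?d (Z \<omega>) (X \<omega>) t s} \<partial>lborel \<partial>lborel)
      \<le> (\<integral>\<^sup>+t. \<integral>\<^sup>+s. emeasure M {\<omega>\<in>space M. layer D ?d (U \<omega>) (V \<omega>) t s} \<partial>lborel \<partial>lborel)"
      using co Z X U V mono dm by (intro nn_integral_mono comonotonic_layer_le)
    then show "(\<integral>\<^sup>+\<omega>. ennreal (bregman D f (Z \<omega>) (X \<omega>)) \<partial>M)
        \<le> (\<integral>\<^sup>+\<omega>. ennreal (bregman D f (U \<omega>) (V \<omega>)) \<partial>M)"
      using nn_integral_bregman_layers(2)[OF sigma_finite_measure_axioms f Z X _ dm]
        nn_integral_bregman_layers(2)[OF sigma_finite_measure_axioms f U V _ dm]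
      by simp
  qed
qed

lemma random_vectors_component:
  assumes "X \<in> random_vectors M (power_domain D)"
  shows "(\<lambda>\<omega>. X \<omega> $ i) \<in> random_vectors M D"
proof -
  have "(\<lambda>\<omega>. X \<omega> \<bullet> axis i 1) \<in> borel_measurable M"
    using assms by (intro borel_measurable_inner) (auto simp: random_vectors_def)
  then show ?thesis
    using assms by (auto simp: random_vectors_def power_domain_def inner_axis)
qed

text \<open>A marginal distribution function is a limit of joint ones rather than one of their
  values; passing through the joint law and its image under projection avoids that limit.\<close>

lemma (in prob_space) rv_cdf_component:
  fixes X Y :: "'a \<Rightarrow> real ^ 'n"
  assumes [measurable]: "X \<in> borel_measurable M" "Y \<in> borel_measurable M"
    and eq: "rv_cdf M X = rv_cdf M Y"
  shows "rv_cdf M (\<lambda>\<omega>. X \<omega> $ i) = rv_cdf M (\<lambda>\<omega>. Y \<omega> $ i)"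
proof -
  have "distr M borel (\<lambda>\<omega>. X \<omega> $ i) = distr (distr M borel X) borel (\<lambda>x. x $ i)"
    if [measurable]: "X \<in> borel_measurable M" for X :: "'a \<Rightarrow> real ^ 'n"
    by (subst distr_distr) (auto simp: comp_def)
  then show ?thesis
    using rv_cdf_eq_imp_distr_eq[OF assms] by (simp add: rv_cdf_def)
qed

lemma (in prob_space) nn_integral_bregman_separable:
  fixes \<Phi> :: "real ^ 'n \<Rightarrow> real" and \<phi> :: "'n \<Rightarrow> real \<Rightarrow> real"
  assumes "convex D" "bregman_generator (power_domain D) \<Phi>"
    and gen: "\<And>k. bregman_generator D (\<phi> k)"
    and sep: "\<And>x. x \<in> power_domain D \<Longrightarrow> \<Phi> x = (\<Sum>k\<in>UNIV. \<phi> k (x $ k))"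
    and U: "U \<in> random_vectors M (power_domain D)" and V: "V \<in> random_vectors M (power_domain D)"
  shows "(\<integral>\<^sup>+\<omega>. ennreal (bregman (power_domain D) \<Phi> (U \<omega>) (V \<omega>)) \<partial>M)
    = (\<Sum>k\<in>UNIV. \<integral>\<^sup>+\<omega>. ennreal (bregman D (\<phi> k) (U \<omega> $ k) (V \<omega> $ k)) \<partial>M)"
proof -
  have "(\<integral>\<^sup>+\<omega>. ennreal (bregman (power_domain D) \<Phi> (U \<omega>) (V \<omega>)) \<partial>M)
    = (\<integral>\<^sup>+\<omega>. (\<Sum>k\<in>UNIV. ennreal (bregman D (\<phi> k) (U \<omega> $ k) (V \<omega> $ k))) \<partial>M)"
  proof (rule nn_integral_cong)
    fix \<omega> assume "\<omega> \<in> space M"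
    then have UV: "U \<omega> \<in> power_domain D" "V \<omega> \<in> power_domain D"
      using U V by (auto simp: random_vectors_def)
    have "bregman (power_domain D) \<Phi> (U \<omega>) (V \<omega>) = (\<Sum>k\<in>UNIV. bregman D (\<phi> k) (U \<omega> $ k) (V \<omega> $ k))"
      using assms UV by (intro bregman_separable)
    then show "ennreal (bregman (power_domain D) \<Phi> (U \<omega>) (V \<omega>))
        = (\<Sum>k\<in>UNIV. ennreal (bregman D (\<phi> k) (U \<omega> $ k) (V \<omega> $ k)))"
      using UV gen by (simp add: sum_ennreal bregman_nonneg power_domain_def)
  qed
  also have "\<dots> = (\<Sum>k\<in>UNIV. \<integral>\<^sup>+\<omega>. ennreal (bregman D (\<phi> k) (U \<omega> $ k) (V \<omega> $ k)) \<partial>M)"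
    using U V by (intro nn_integral_sum bregman_measurable gen random_vectors_component)
  finally show ?thesis .
qed

theorem theorem3:
  fixes M :: "'a measure"
    and D :: "real set"
    and \<Phi> :: "real ^ 'n \<Rightarrow> real"
    and \<phi> :: "'n \<Rightarrow> real \<Rightarrow> real"
    and X :: "'a \<Rightarrow> real ^ 'n"
    and \<epsilon> :: real
  assumes "prob_space M"
    and "nonatomic M"
    and "convex D"
    and "bregman_generator (power_domain D) \<Phi>"
    and "\<And>k. bregman_generator D (\<phi> k)"
    and "\<And>x. x \<in> power_domain D \<Longrightarrow> \<Phi> x = (\<Sum>k\<in>UNIV. \<phi> k (x $ k))"
    and "0 \<le> \<epsilon>"
    and "X \<in> random_vectors M (power_domain D)"
  shows "BW_set M (power_domain D) \<Phi> \<epsilon> X \<subseteq> componentwise_BW_set M D \<phi> \<epsilon> X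
    \<and> BW_set M (power_domain D) \<Phi> \<epsilon> X \<inter> componentwise_comonotonic M D X
      = componentwise_BW_set M D \<phi> \<epsilon> X \<inter> componentwise_comonotonic M D X"
proof -
  interpret prob_space M by fact
  let ?S = "power_domain D :: (real ^ 'n) set"
  have separable: "(\<integral>\<^sup>+\<omega>. ennreal (bregman ?S \<Phi> (U \<omega>) (V \<omega>)) \<partial>M)
      = (\<Sum>k\<in>UNIV. \<integral>\<^sup>+\<omega>. ennreal (bregman D (\<phi> k) (U \<omega> $ k) (V \<omega> $ k)) \<partial>M)"
    if "U \<in> random_vectors M ?S" "V \<in> random_vectors M ?S" for U V
    using assms that by (intro nn_integral_bregman_separable)
  \<comment> \<open>Components of a coupling of vectors couple the components, so the sum of the
    separate infima lies below every joint cost. This holds for all \<open>Z\<close> and gives the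
    inclusion.\<close>
  have le: "(\<Sum>i\<in>UNIV. BW_div_rv M D (\<phi> i) (\<lambda>\<omega>. Z \<omega> $ i) (\<lambda>\<omega>. X \<omega> $ i))
      \<le> BW_div M ?S \<Phi> (rv_cdf M Z) (rv_cdf M X)"
    if Z: "Z \<in> random_vectors M ?S" for Z
    unfolding BW_div_def
  proof (rule INF_greatest, clarify)
    fix U V assume "(U, V) \<in> couplings M ?S (rv_cdf M Z) (rv_cdf M X)"
    then have U: "U \<in> random_vectors M ?S" and V: "V \<in> random_vectors M ?S"
      and eq: "rv_cdf M Z = rv_cdf M U" "rv_cdf M X = rv_cdf M V"
      by (auto simp: couplings_def)
    have "(\<Sum>i\<in>UNIV. BW_div_rv M D (\<phi> i) (\<lambda>\<omega>. Z \<omega> $ i) (\<lambda>\<omega>. X \<omega> $ i))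
        \<le> (\<Sum>i\<in>UNIV. \<integral>\<^sup>+\<omega>. ennreal (bregman D (\<phi> i) (U \<omega> $ i) (V \<omega> $ i)) \<partial>M)"
    proof (rule sum_mono)
      fix i
      have "rv_cdf M (\<lambda>\<omega>. Z \<omega> $ i) = rv_cdf M (\<lambda>\<omega>. U \<omega> $ i)"
        "rv_cdf M (\<lambda>\<omega>. X \<omega> $ i) = rv_cdf M (\<lambda>\<omega>. V \<omega> $ i)"
        using U V Z assms(8) eq by (auto intro!: rv_cdf_component simp: random_vectors_def)
      then show "BW_div_rv M D (\<phi> i) (\<lambda>\<omega>. Z \<omega> $ i) (\<lambda>\<omega>. X \<omega> $ i)
          \<le> (\<integral>\<^sup>+\<omega>. ennreal (bregman D (\<phi> i) (U \<omega> $ i) (V \<omega> $ i)) \<partial>M)"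
        unfolding BW_div_rv_def using U V
        by (simp add: BW_div_le_coupling random_vectors_component)
    qed
    then show "(\<Sum>i\<in>UNIV. BW_div_rv M D (\<phi> i) (\<lambda>\<omega>. Z \<omega> $ i) (\<lambda>\<omega>. X \<omega> $ i))
        \<le> (\<integral>\<^sup>+\<omega>. ennreal (bregman ?S \<Phi> (U \<omega>) (V \<omega>)) \<partial>M)"
      by (simp add: separable[OF U V])
  qed
  \<comment> \<open>The pair \<open>(Z, X)\<close> is itself a coupling, and each of its components
    is optimal, so a single coupling attains all the infima at once.\<close>
  have ge: "BW_div M ?S \<Phi> (rv_cdf M Z) (rv_cdf M X)
      \<le> (\<Sum>i\<in>UNIV. BW_div_rv M D (\<phi> i) (\<lambda>\<omega>. Z \<omega> $ i) (\<lambda>\<omega>. X \<omega> $ i))"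
    if Z: "Z \<in> random_vectors M ?S" and co: "\<And>i. comonotonic M (\<lambda>\<omega>. Z \<omega> $ i) (\<lambda>\<omega>. X \<omega> $ i)" for Z
  proof -
    have "BW_div M ?S \<Phi> (rv_cdf M Z) (rv_cdf M X)
        \<le> (\<integral>\<^sup>+\<omega>. ennreal (bregman ?S \<Phi> (Z \<omega>) (X \<omega>)) \<partial>M)"
      using Z assms(8) by (rule BW_div_le_coupling)
    also have "\<dots> = (\<Sum>i\<in>UNIV. BW_div_rv M D (\<phi> i) (\<lambda>\<omega>. Z \<omega> $ i) (\<lambda>\<omega>. X \<omega> $ i))"
      using separable[OF Z assms(8)]
        BW_div_comonotonic[OF assms(5) co random_vectors_component[OF Z] random_vectors_component[OF assms(8)]]
      by simp
    finally show ?thesis .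
  qed
  have sub: "BW_set M ?S \<Phi> \<epsilon> X \<subseteq> componentwise_BW_set M D \<phi> \<epsilon> X"
    using le by (fastforce simp: BW_set_def componentwise_BW_set_def intro: order_trans)
  moreover have "componentwise_BW_set M D \<phi> \<epsilon> X \<inter> componentwise_comonotonic M D X
      \<subseteq> BW_set M ?S \<Phi> \<epsilon> X"
    using ge by (fastforce simp: BW_set_def componentwise_BW_set_def componentwise_comonotonic_def
        intro: order_trans)
  ultimately show ?thesis
    by blast
qed

end
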